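(* Let $\mu$ be an isotropic probability measure on $\mathbb{R}^n$ satisfying $\mathrm{CWSM}(\gamma)$. Then: (i) $\int\big|\|x\|_2-\sqrt n\big|^2d\mu(x)\le\gamma^2$; (ii) if $\mu$ is also $\alpha$-regular, then for all $p>2$, $$\Big(\int\|x\|_2^p\,d\mu\Big)^{1/p}\le\sqrt n+\frac{\gamma\alpha}{2}p.$$
   Context: $\|\cdot\|_2$ is the Euclidean norm. $\mu$ is isotropic if $\int\langle u,x\rangle d\mu(x)=0$ and $\int\langle u,x\rangle^2d\mu(x)=\|u\|_2^2$ for all $u\in\mathbb{R}^n$. $\mu$ is $\alpha$-regular if for all $p\ge q\ge2$ and $v\in\mathbb{R}^n$, $(\int|\langle v,x\rangle|^pd\mu)^{1/p}\le\alpha\frac pq(\int|\langle v,x\rangle|^qd\mu)^{1/q}$. $\mu$ has comparable weak and strong moments with constant $\gamma$ ($\mathrm{CWSM}(\gamma)$) if for every norm $\|\cdot\|$ on $\mathbb{R}^n$, with dual norm $\|\cdot\|_*$, and all $p\ge q\ge2$, $$\Big(\int\Big|\|x\|-\Big(\int\|x\|^qd\mu\Big)^{1/q}\Big|^pd\mu\Big)^{1/p}\le\gamma\sup_{\|u\|_*\le1}\Big(\int|\langle u,x\rangle|^pd\mu\Big)^{1/p}.$$ *)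

theory Defs
  imports "HOL-Probability.Probability"
begin

text \<open>
  The extended-real-valued $L^p$ norm. It is \<open>\<infinity>\<close> when the $p$-th absolute moment diverges,
  whereas the Bochner integral would return 0 there.
\<close>

definition Lp_norm :: "'a measure \<Rightarrow> real \<Rightarrow> ('a \<Rightarrow> real) \<Rightarrow> ereal" where
  "Lp_norm M p f =
     (let I = (\<integral>\<^sup>+ x. ennreal (\<bar>f x\<bar> powr p) \<partial>M)
      in if I = \<infinity> then \<infinity> else ereal (enn2real I powr (1 / p)))"

definition isotropic :: "(real ^ 'n) measure \<Rightarrow> bool" where
  "isotropic M \<longleftrightarrow>
     (\<forall>u. integrable M (\<lambda>x. u \<bullet> x) \<and> (\<integral>x. u \<bullet> x \<partial>M) = 0 \<and>
          integrable M (\<lambda>x. (u \<bullet> x)\<^sup>2) \<and> (\<integral>x. (u \<bullet> x)\<^sup>2 \<partial>M) = (norm u)\<^sup>2)"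

definition regular_measure :: "real \<Rightarrow> (real ^ 'n) measure \<Rightarrow> bool" where
  "regular_measure \<alpha> M \<longleftrightarrow>
     (\<forall>p q v. p \<ge> q \<and> q \<ge> 2 \<longrightarrow>
        Lp_norm M p (\<lambda>x. v \<bullet> x) \<le> ereal (\<alpha> * (p / q)) * Lp_norm M q (\<lambda>x. v \<bullet> x))"

definition is_norm :: "('a::real_vector \<Rightarrow> real) \<Rightarrow> bool" where
  "is_norm N \<longleftrightarrow>
     (\<forall>x. N x \<ge> 0) \<and> (\<forall>x. N x = 0 \<longleftrightarrow> x = 0) \<and>
     (\<forall>c x. N (c *\<^sub>R x) = \<bar>c\<bar> * N x) \<and> (\<forall>x y. N (x + y) \<le> N x + N y)"

definition dual_norm :: "(real ^ 'n \<Rightarrow> real) \<Rightarrow> real ^ 'n \<Rightarrow> real" where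
  "dual_norm N u = (SUP x\<in>{x. N x \<le> 1}. u \<bullet> x)"

text \<open>
  Comparable weak and strong moments. If the $q$-th moment of \<open>N\<close> diverges, \<open>real_of_ereal\<close>
  sends it to 0; for a probability measure the left-hand side is then the $L^p$ norm of \<open>N\<close>,
  which is \<open>\<infinity>\<close> because \<open>p \<ge> q\<close>, as it should be for the $L^p$ norm of \<open>\<bar>N - \<infinity>\<bar>\<close>.
\<close>

definition CWSM :: "real \<Rightarrow> (real ^ 'n) measure \<Rightarrow> bool" where
  "CWSM \<gamma> M \<longleftrightarrow>
     (\<forall>N p q. is_norm N \<and> p \<ge> q \<and> q \<ge> 2 \<longrightarrow>
        Lp_norm M p (\<lambda>x. N x - real_of_ereal (Lp_norm M q N))
          \<le> ereal \<gamma> * (SUP u\<in>{u. dual_norm N u \<le> 1}. Lp_norm M p (\<lambda>x. u \<bullet> x)))"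

end

theory Submission
  imports Defs
begin

text \<open>
  The idea is to apply the CWSM inequality to the Euclidean norm with \<open>q = 2\<close>. The Euclidean
  norm is its own dual, and summing the isotropy condition over an orthonormal basis gives
  \<open>\<integral> \<parallel>x\<parallel>\<^sup>2 d\<mu> = n\<close>, so the inequality says that the \<open>L\<^sup>p\<close> norm of \<open>\<parallel>x\<parallel> - \<surd>n\<close> is at most \<open>\<gamma>\<close> times
  the weak moment \<open>sup {\<parallel>\<langle>u, \<cdot>\<rangle>\<parallel>\<^sub>p | \<parallel>u\<parallel> \<le> 1}\<close> (lemma \<open>CWSM_euclidean\<close>).

  At \<open>p = 2\<close> isotropy makes the weak moment equal to 1, which is part (i) after squaring. At
  \<open>p > 2\<close> regularity with \<open>q = 2\<close> bounds it by \<open>\<alpha> p / 2\<close>, and the triangle inequality in \<open>L\<^sup>p\<close>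
  turns the bound on the deviation from \<open>\<surd>n\<close> into part (ii). Here the
  triangle inequality only adds a constant on a probability space, so it follows from the
  convexity of \<open>t \<mapsto> t\<^sup>p\<close> (lemma \<open>Lp_norm_le_shift\<close>).
\<close>

lemma Lp_norm_le_iff:
  assumes "A \<ge> 0" and "p > 0"
  shows "Lp_norm M p f \<le> ereal A \<longleftrightarrow>
    (\<integral>\<^sup>+ x. ennreal (\<bar>f x\<bar> powr p) \<partial>M) \<le> ennreal (A powr p)"
proof (cases "(\<integral>\<^sup>+ x. ennreal (\<bar>f x\<bar> powr p) \<partial>M)" rule: ennreal_cases)
  case (real r)
  have "r powr (1 / p) \<le> A \<longleftrightarrow> r \<le> A powr p"
  proof
    assume "r powr (1 / p) \<le> A"
    then have "(r powr (1 / p)) powr p \<le> A powr p"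
      using assms by (intro powr_mono2) auto
    then show "r \<le> A powr p" using assms real by (simp add: powr_powr)
  next
    assume "r \<le> A powr p"
    then have "r powr (1 / p) \<le> (A powr p) powr (1 / p)"
      using assms real by (intro powr_mono2) auto
    then show "r powr (1 / p) \<le> A" using assms by (simp add: powr_powr)
  qed
  then show ?thesis using real by (simp add: Lp_norm_def)
next
  case top
  then show ?thesis by (simp add: Lp_norm_def top_unique)
qed

lemma Lp_norm_nonneg: "0 \<le> Lp_norm M p f"
  by (simp add: Lp_norm_def Let_def)

lemma Lp_norm_2_eq:
  assumes "(\<integral>\<^sup>+ x. ennreal ((f x)\<^sup>2) \<partial>M) = ennreal (s\<^sup>2)" and "s \<ge> 0"
  shows "Lp_norm M 2 f = ereal s"
proof -
  have "(\<integral>\<^sup>+ x. ennreal (\<bar>f x\<bar> powr 2) \<partial>M) = ennreal (s\<^sup>2)"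
    using assms(1) by simp
  then show ?thesis
    using assms(2) by (simp add: Lp_norm_def powr_half_sqrt)
qed

text \<open>
  Convexity of \<open>t \<mapsto> t\<^sup>p\<close> applied to \<open>(y + c) / (A + c)\<close>, written as the average of \<open>y / A\<close> and \<open>1\<close>
  with weights \<open>A / (A + c)\<close> and \<open>c / (A + c)\<close>. These weights are the ones that make the right-hand
  side equal to \<open>(A + c)\<^sup>p\<close> when \<open>y\<^sup>p\<close> is replaced by \<open>A\<^sup>p\<close>; hence integrating this bound
  gives the triangle inequality with its sharp constant.
\<close>

lemma powr_add_le_weighted:
  fixes y A c p :: real
  assumes "y \<ge> 0" "A > 0" "c \<ge> 0" "p \<ge> 1"
  shows "(y + c) powr p
    \<le> (A + c) powr p * (A / (A + c) * (1 / A powr p) * y powr p + c / (A + c))"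
proof -
  define s where "s = c / (A + c)"
  have s: "0 \<le> s" "s \<le> 1" and s': "1 - s = A / (A + c)"
    using assms by (auto simp: s_def field_simps)
  have *: "((1 - s) * (y / A) + s * 1) powr p \<le> (1 - s) * (y / A) powr p + s * 1 powr p"
    \<comment> \<open>For \<open>y = 0\<close> the claim is \<open>s\<^sup>p \<le> s\<close>; for \<open>y > 0\<close> it is convexity on the open half-line.\<close>
  proof (cases "y = 0")
    case True
    have "s powr p \<le> s powr 1"
      using s assms by (intro powr_mono') auto
    then show ?thesis using True s by simp
  next
    case False
    then show ?thesis
      using convex_onD[OF powr_convex[OF \<open>p \<ge> 1\<close>], of s "y / A" 1] s assms by simp
  qed
  have "y + c = (A + c) * ((1 - s) * (y / A) + s * 1)"
    unfolding s' using assms by (simp add: s_def flip: add_divide_distrib)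
  then have "(y + c) powr p = (A + c) powr p * ((1 - s) * (y / A) + s * 1) powr p"
    using s assms by (simp add: powr_mult)
  also have "\<dots> \<le> (A + c) powr p * ((1 - s) * (y / A) powr p + s * 1 powr p)"
    by (intro mult_left_mono *) simp
  finally show ?thesis
    using assms unfolding s' by (simp add: s_def powr_divide)
qed

text \<open>
  Minkowski's inequality for \<open>f = (f - c) + c\<close>: the constant \<open>c\<close> has \<open>L\<^sup>p\<close> norm \<open>\<bar>c\<bar>\<close> on a
  probability space.
\<close>

lemma Lp_norm_le_shift:
  fixes f :: "'a \<Rightarrow> real"
  assumes M: "prob_space M" and [measurable]: "f \<in> borel_measurable M"
    and "A \<ge> 0" "p \<ge> 1" and le: "Lp_norm M p (\<lambda>x. f x - c) \<le> ereal A"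
  shows "Lp_norm M p f \<le> ereal (A + \<bar>c\<bar>)"
proof (rule ereal_le_epsilon2)
  interpret prob_space M by fact
  fix e :: real assume "e > 0"
  \<comment> \<open>The weighted bound divides by its parameter, so \<open>A\<close>, which may be 0, is enlarged slightly.\<close>
  define B where "B = A + e"
  define k where "k = B / (B + \<bar>c\<bar>) * (1 / B powr p)"
  define d where "d = \<bar>c\<bar> / (B + \<bar>c\<bar>)"
  have B: "B > 0" using \<open>A \<ge> 0\<close> \<open>e > 0\<close> by (simp add: B_def)
  have kd: "k \<ge> 0" "d \<ge> 0" using B by (simp_all add: k_def d_def)
  have "Lp_norm M p (\<lambda>x. f x - c) \<le> ereal B"
    using le \<open>e > 0\<close> by (simp add: B_def order_trans[OF le])
  then have I: "(\<integral>\<^sup>+ x. ennreal (\<bar>f x - c\<bar> powr p) \<partial>M) \<le> ennreal (B powr p)"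
    using Lp_norm_le_iff B \<open>p \<ge> 1\<close> by (metis less_eq_real_def less_le_trans zero_less_one)
  have "(\<integral>\<^sup>+ x. ennreal (\<bar>f x\<bar> powr p) \<partial>M)
      \<le> (\<integral>\<^sup>+ x. ennreal ((B + \<bar>c\<bar>) powr p) *
            (ennreal k * ennreal (\<bar>f x - c\<bar> powr p) + ennreal d) \<partial>M)"
  proof (rule nn_integral_mono)
    fix x
    have "\<bar>f x\<bar> powr p \<le> (\<bar>f x - c\<bar> + \<bar>c\<bar>) powr p"
      using \<open>p \<ge> 1\<close> by (intro powr_mono2) auto
    also have "\<dots> \<le> (B + \<bar>c\<bar>) powr p * (k * \<bar>f x - c\<bar> powr p + d)"
      unfolding k_def d_def using B \<open>p \<ge> 1\<close> by (intro powr_add_le_weighted) auto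
    finally show "ennreal (\<bar>f x\<bar> powr p) \<le> ennreal ((B + \<bar>c\<bar>) powr p) *
        (ennreal k * ennreal (\<bar>f x - c\<bar> powr p) + ennreal d)"
      using kd by (simp flip: ennreal_mult ennreal_plus add: ennreal_leI)
  qed
  also have "\<dots> = ennreal ((B + \<bar>c\<bar>) powr p) *
      (ennreal k * (\<integral>\<^sup>+ x. ennreal (\<bar>f x - c\<bar> powr p) \<partial>M) + ennreal d)"
    by (simp add: nn_integral_cmult nn_integral_add emeasure_space_1)
  also have "\<dots> \<le> ennreal ((B + \<bar>c\<bar>) powr p) * (ennreal k * ennreal (B powr p) + ennreal d)"
    by (intro mult_left_mono add_right_mono I) auto
  also have "\<dots> = ennreal ((B + \<bar>c\<bar>) powr p * (k * B powr p + d))"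
    using kd by (simp flip: ennreal_mult ennreal_plus)
  also have "k * B powr p + d = 1"
    using B by (simp add: k_def d_def flip: add_divide_distrib)
  finally have "Lp_norm M p f \<le> ereal (B + \<bar>c\<bar>)"
    using B \<open>p \<ge> 1\<close> by (subst Lp_norm_le_iff) auto
  then show "Lp_norm M p f \<le> ereal (A + \<bar>c\<bar>) + ereal e"
    by (simp add: B_def algebra_simps)
qed

lemma is_norm_norm: "is_norm norm"
  by (auto simp: is_norm_def norm_triangle_ineq)

lemma dual_norm_norm: "dual_norm norm u = norm u"
  unfolding dual_norm_def
proof (rule cSup_eq_maximum)
  show "norm u \<in> (\<lambda>x. u \<bullet> x) ` {x. norm x \<le> 1}"
  proof (rule image_eqI)
    show "norm u = u \<bullet> sgn u"
      by (cases "u = 0") (simp_all add: sgn_div_norm dot_square_norm power2_eq_square)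
    show "sgn u \<in> {x. norm x \<le> 1}" by (simp add: norm_sgn)
  qed
  show "y \<le> norm u" if "y \<in> (\<lambda>x. u \<bullet> x) ` {x. norm x \<le> 1}" for y
    using that by (auto intro!: order_trans[OF norm_cauchy_schwarz] mult_left_le)
qed

lemma isotropic_Lp_norm_2_inner:
  assumes "isotropic M"
  shows "Lp_norm M 2 (\<lambda>x. u \<bullet> x) = ereal (norm u)"
  using assms by (intro Lp_norm_2_eq) (auto simp: isotropic_def nn_integral_eq_integral)

lemma isotropic_Lp_norm_2_norm:
  fixes M :: "(real ^ 'n) measure"
  assumes "isotropic M"
  shows "Lp_norm M 2 norm = ereal (sqrt (real CARD('n)))"
proof (rule Lp_norm_2_eq)
  have sq: "(norm x)\<^sup>2 = (\<Sum>b\<in>Basis. (b \<bullet> x)\<^sup>2)" for x :: "real ^ 'n"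
    unfolding power2_norm_eq_inner
    by (subst euclidean_inner) (simp add: power2_eq_square inner_commute)
  have "integrable M (\<lambda>x. (norm x)\<^sup>2)" "(\<integral>x. (norm x)\<^sup>2 \<partial>M) = real CARD('n)"
    unfolding sq using assms by (auto simp: isotropic_def)
  then show "(\<integral>\<^sup>+ x. ennreal ((norm x)\<^sup>2) \<partial>M) = ennreal ((sqrt (real CARD('n)))\<^sup>2)"
    by (simp add: nn_integral_eq_integral)
qed simp

text \<open>
  CWSM with \<open>q = 2\<close> for the Euclidean norm: isotropy identifies the centre of the strong
  deviation as \<open>\<surd>n\<close>, and self-duality makes the supremum range over the Euclidean unit ball.
\<close>

lemma CWSM_euclidean:
  fixes M :: "(real ^ 'n) measure"
  assumes "isotropic M" "CWSM \<gamma> M" "p \<ge> 2"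
  shows "Lp_norm M p (\<lambda>x. norm x - sqrt (real CARD('n)))
    \<le> ereal \<gamma> * (SUP u\<in>{u. norm u \<le> 1}. Lp_norm M p (\<lambda>x. u \<bullet> x))"
proof -
  have "Lp_norm M p (\<lambda>x. norm x - real_of_ereal (Lp_norm M 2 norm))
      \<le> ereal \<gamma> * (SUP u\<in>{u. dual_norm norm u \<le> 1}. Lp_norm M p (\<lambda>x. u \<bullet> x))"
    using assms(2,3) is_norm_norm unfolding CWSM_def by blast
  then show ?thesis
    by (simp add: dual_norm_norm isotropic_Lp_norm_2_norm[OF assms(1)])
qed

lemma isotropic_weak_moment_2:
  fixes M :: "(real ^ 'n) measure"
  assumes "isotropic M"
  shows "(SUP u\<in>{u. norm u \<le> 1}. Lp_norm M 2 (\<lambda>x. u \<bullet> x)) = 1"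
proof -
  obtain b :: "real ^ 'n" where "norm b = 1" using vector_choose_size[of 1] by auto
  then show ?thesis
    unfolding isotropic_Lp_norm_2_inner[OF assms]
    by (intro antisym SUP_least SUP_upper2[of b]) (auto simp: one_ereal_def)
qed

theorem proposition3p15:
  fixes \<mu> :: "(real ^ 'n) measure" and \<gamma> :: real
  assumes "prob_space \<mu>"
    and "sets \<mu> = sets borel"
    and "isotropic \<mu>"
    and "CWSM \<gamma> \<mu>"
  shows "(\<integral>\<^sup>+ x. ennreal (\<bar>norm x - sqrt (real CARD('n))\<bar>\<^sup>2) \<partial>\<mu>) \<le> ennreal (\<gamma>\<^sup>2) \<and>
    (\<forall>\<alpha>. regular_measure \<alpha> \<mu> \<longrightarrow>
      (\<forall>p>2. Lp_norm \<mu> p norm \<le> ereal (sqrt (real CARD('n)) + \<gamma> * \<alpha> / 2 * p)))"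
proof (intro conjI allI impI)
  let ?n = "sqrt (real CARD('n))"
  have L2: "Lp_norm \<mu> 2 (\<lambda>x. norm x - ?n) \<le> ereal \<gamma>"
    using CWSM_euclidean[OF assms(3,4), of 2] isotropic_weak_moment_2[OF assms(3)] by simp
  have "0 \<le> ereal \<gamma>"
    using Lp_norm_nonneg L2 by (rule order_trans)
  then have \<gamma>: "0 \<le> \<gamma>" by simp
  show "(\<integral>\<^sup>+ x. ennreal (\<bar>norm x - ?n\<bar>\<^sup>2) \<partial>\<mu>) \<le> ennreal (\<gamma>\<^sup>2)"
    using L2 \<gamma> by (simp add: Lp_norm_le_iff)
  fix \<alpha> p :: real
  assume reg: "regular_measure \<alpha> \<mu>" and p: "p > 2"
  have reg_le: "Lp_norm \<mu> r (\<lambda>x. u \<bullet> x) \<le> ereal (\<alpha> * (r / 2) * norm u)" if "r \<ge> 2" for r u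
    using reg that isotropic_Lp_norm_2_inner[OF assms(3), of u]
    unfolding regular_measure_def by (metis order_refl times_ereal.simps(1))
  obtain b :: "real ^ 'n" where b: "norm b = 1" using vector_choose_size[of 1] by auto
  \<comment> \<open>Regularity at \<open>p = q = 2\<close> fixes the sign of \<open>\<alpha>\<close>: a unit vector has a nonzero second moment.\<close>
  have \<alpha>: "\<alpha> \<ge> 0"
    using order_trans[OF Lp_norm_nonneg reg_le[of 2 b]] b by simp
  have "Lp_norm \<mu> p (\<lambda>x. norm x - ?n)
      \<le> ereal \<gamma> * (SUP u\<in>{u. norm u \<le> 1}. Lp_norm \<mu> p (\<lambda>x. u \<bullet> x))"
    using assms p by (intro CWSM_euclidean) auto
  also have "\<dots> \<le> ereal \<gamma> * ereal (\<alpha> * (p / 2))"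
  proof (intro ereal_mult_left_mono SUP_least)
    fix u :: "real ^ 'n" assume "u \<in> {u. norm u \<le> 1}"
    then have "\<alpha> * (p / 2) * norm u \<le> \<alpha> * (p / 2)"
      using \<alpha> p by (intro mult_left_le) auto
    then show "Lp_norm \<mu> p (\<lambda>x. u \<bullet> x) \<le> ereal (\<alpha> * (p / 2))"
      using reg_le[of p u] p by (auto intro: order_trans)
  qed (use \<gamma> in simp)
  finally have "Lp_norm \<mu> p (\<lambda>x. norm x - ?n) \<le> ereal (\<gamma> * \<alpha> / 2 * p)"
    by (simp add: algebra_simps)
  then have "Lp_norm \<mu> p norm \<le> ereal (\<gamma> * \<alpha> / 2 * p + \<bar>?n\<bar>)"
    using assms(1,2) \<alpha> \<gamma> p
    by (intro Lp_norm_le_shift) (auto simp: measurable_cong_sets[OF assms(2) refl])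
  then show "Lp_norm \<mu> p norm \<le> ereal (?n + \<gamma> * \<alpha> / 2 * p)"
    by (simp add: add.commute)
qed

end
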